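(* For every prime $p$ and every integer $N$ with $2\le N<p$, we have $$ I_p(N)\ge (1+o(1))\frac{N^2}{p(\log N)^2}, $$ where $o(1)$ denotes a quantity that tends to $0$ as $N\to\infty$, uniformly over primes $p>N$.
   Context: For a prime $p$ and an integer $u$ with $\gcd(u,p)=1$, the Fermat quotient $q_p(u)$ is the unique integer with $q_p(u)\equiv \frac{u^{p-1}-1}{p}\pmod p$ and $0\le q_p(u)\le p-1$. The image size of the first $N$ Fermat quotients is $$I_p(N)=\#\{q_p(n)\ :\ 1\le n\le N,\ \gcd(n,p)=1\}.$$ *)

theory Defs
  imports Complex_Main "HOL-Number_Theory.Number_Theory"
begin

text \<open>The division by \<open>p\<close> is exact for \<open>u\<close> coprime to the prime \<open>p\<close>, and reduction by \<open>mod\<close>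
  on \<open>int\<close> picks the representative in \<open>{0..p-1}\<close>; see \<open>fermat_quotient_exact\<close> and
  \<open>fermat_quotient_unique\<close>. For other \<open>u\<close> the value is irrelevant.\<close>

definition fermat_quotient :: "nat \<Rightarrow> int \<Rightarrow> int" where
  "fermat_quotient p u = ((u ^ (p - 1) - 1) div int p) mod int p"

definition fermat_image_size :: "nat \<Rightarrow> nat \<Rightarrow> nat" where
  "fermat_image_size p N =
     card {fermat_quotient p (int n) | n. 1 \<le> n \<and> n \<le> N \<and> coprime n p}"

lemma fermat_quotient_exact:
  assumes "prime p" and "coprime u (int p)"
  shows "int p * ((u ^ (p - 1) - 1) div int p) = u ^ (p - 1) - 1"
proof -
  define a where "a = nat (u mod int p)"
  have a: "int a = u mod int p"
    using prime_gt_0_nat[OF assms(1)] by (simp add: a_def)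
  have "coprime (u mod int p) (int p)"
    using assms(2) prime_gt_0_nat[OF assms(1)] by (simp add: coprime_mod_left_iff)
  then have "coprime a p"
    by (simp flip: a)
  then have "[a ^ (p - 1) = 1] (mod p)"
    using euler_theorem[of a p] assms(1) by (simp add: totient_prime)
  then have "[int a ^ (p - 1) = 1] (mod int p)"
    by (metis cong_int_iff of_nat_1 of_nat_power)
  moreover have "[int a ^ (p - 1) = u ^ (p - 1)] (mod int p)"
    unfolding a by (rule cong_pow) (simp add: cong_def)
  ultimately have "[u ^ (p - 1) = 1] (mod int p)"
    by (metis cong_sym cong_trans)
  then show ?thesis
    by (simp add: cong_iff_dvd_diff)
qed

lemma fermat_quotient_unique:
  assumes "prime p"
  shows "q = fermat_quotient p u \<longleftrightarrow>
    [q = (u ^ (p - 1) - 1) div int p] (mod int p) \<and> 0 \<le> q \<and> q \<le> int p - 1"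
  using prime_gt_0_nat[OF assms]
  by (auto simp: fermat_quotient_def cong_def)

end

theory Submission
  imports Defs "HOL-Analysis.Convex" "HOL-Analysis.Harmonic_Numbers" "HOL-Real_Asymp.Real_Asymp"
begin

text \<open>
  Let \<open>S\<close> be a set of \<open>m\<close> odd primes up to \<open>N\<close>. By Cauchy--Schwarz,
  \<open>m\<^sup>2 \<le> I\<^sub>p(N) E\<close>, where \<open>E\<close> counts the pairs in \<open>S \<times> S\<close> with equal Fermat
  quotients. For such pairs with \<open>a \<noteq> b\<close> the map \<open>((a, b), s) \<mapsto> s a / b mod p\<close>, \<open>s = \<plusminus>1\<close>,
  is injective: the residue of \<open>s a / b\<close> modulo \<open>p\<close> determines it modulo \<open>p\<^sup>2\<close>, and
  all products involved are smaller than \<open>p\<^sup>2\<close>. Hence \<open>E \<le> m + p / 2\<close>.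

  The signs gain a factor 2 over the plain count \<open>E \<le> m + p\<close>, so the prime number theorem is
  not needed: a lower bound \<open>\<pi>(N) \<ge> c N / ln N\<close> with \<open>c > 1 / sqrt 2\<close> is enough, and then the error
  term can be taken to be \<open>0\<close> for all large \<open>N\<close>. The central binomial coefficient only gives
  \<open>c = ln 2\<close>, which is slightly too small; the quotient \<open>(6n)! n! / ((3n)! (2n)!\<^sup>2)\<close> gives
  \<open>c = ln 108 / 6 > 0.78\<close>, of which \<open>c = 5/7\<close> is used.
\<close>

section \<open>A Chebyshev-type lower bound for the number of odd primes\<close>

text \<open>Passing from \<open>n\<close> to \<open>Suc n\<close> raises \<open>n div d\<close>
  exactly at the divisors \<open>d\<close> of \<open>Suc n\<close>, whose Mangoldt values add up to
  \<open>ln (Suc n)\<close>. The free range \<open>m\<close> lets factorials of different arguments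
  share one sum.\<close>

lemma ln_fact_eq_sum_mangoldt:
  assumes "n \<le> m"
  shows "ln (fact n) = (\<Sum>d = 1..m. mangoldt d * real (n div d))"
  using assms
proof (induction n)
  case 0
  then show ?case by simp
next
  case (Suc n)
  have "(\<Sum>d = 1..m. mangoldt d * real (Suc n div d)) =
      (\<Sum>d = 1..m. mangoldt d * real (n div d) + (if d dvd Suc n then mangoldt d else 0))"
    by (intro sum.cong refl) (auto simp: div_Suc dvd_eq_mod_eq_0 algebra_simps)
  also have "\<dots> = ln (fact n) + (\<Sum>d = 1..m. if d dvd Suc n then mangoldt d else 0)"
    using Suc by (simp add: sum.distrib)
  also have "(\<Sum>d = 1..m. if d dvd Suc n then mangoldt d else (0::real)) =
      (\<Sum>d | d dvd Suc n. mangoldt d)"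
    using Suc.prems
    by (intro sum.mono_neutral_cong_right) (auto intro!: Suc_leI Nat.gr0I order.trans[OF dvd_imp_le Suc.prems])
  also have "\<dots> = ln (real (Suc n))"
    by (subst mangoldt_sum) auto
  finally show ?case
    by (simp add: ln_mult_pos)
qed

text \<open>Group the prime powers by their prime: at most \<open>ln x / ln p\<close> powers of
  \<open>p\<close> are \<open>\<le> x\<close>, each with weight \<open>ln p\<close>, so every prime
  contributes at most \<open>ln x\<close>.\<close>

lemma sum_mangoldt_le:
  assumes "x > 0"
  shows "(\<Sum>d = 1..x. mangoldt d) \<le> real (card {p. prime p \<and> p \<le> x}) * ln (real x)"
proof -
  define D where "D = {d \<in> {1..x}. primepow d}"
  define P where "P = {p. prime p \<and> p \<le> x}"
  have fin: "finite D" "finite P"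
    by (auto simp: D_def P_def)
  have ap: "aprimedivisor d \<in> P" if "d \<in> D" for d
  proof -
    have "d > Suc 0" using that by (auto simp: D_def intro: primepow_gt_Suc_0)
    then have "prime (aprimedivisor d)" "aprimedivisor d dvd d"
      by (auto intro: prime_aprimedivisor' aprimedivisor_dvd')
    then show ?thesis
      using that dvd_imp_le[of "aprimedivisor d" d] by (auto simp: D_def P_def)
  qed
  have "(\<Sum>d = 1..x. mangoldt d) = (\<Sum>d\<in>D. ln (real (aprimedivisor d)))"
    by (intro sum.mono_neutral_cong_right) (auto simp: D_def mangoldt_def)
  also have "\<dots> = (\<Sum>p\<in>P. \<Sum>d | d \<in> D \<and> aprimedivisor d = p. ln (real (aprimedivisor d)))"
    by (rule sum.group[symmetric]) (use fin ap in auto)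
  also have "\<dots> \<le> (\<Sum>p\<in>P. ln (real x))"
  proof (rule sum_mono)
    fix p assume "p \<in> P"
    then have p: "prime p" by (auto simp: P_def)
    then have p1: "real p > 1" using prime_gt_1_nat by fastforce
    define K where "K = nat \<lfloor>ln (real x) / ln (real p)\<rfloor>"
    have "{d. d \<in> D \<and> aprimedivisor d = p} \<subseteq> (\<lambda>k. p ^ k) ` {1..K}"
    proof
      fix d assume "d \<in> {d. d \<in> D \<and> aprimedivisor d = p}"
      then have d: "d \<in> D" "aprimedivisor d = p" by auto
      then obtain q k where k: "prime q" "k > 0" "d = q ^ k"
        by (auto simp: D_def primepow_def)
      with d have dk: "d = p ^ k" by (simp add: aprimedivisor_prime_power)
      have "d \<le> x" using d by (simp add: D_def)
      then have "real p ^ k \<le> real x" unfolding dk by (metis of_nat_le_iff of_nat_power)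
      then have "ln (real p ^ k) \<le> ln (real x)" using p1 assms by (subst ln_le_cancel_iff) auto
      then have "real k * ln (real p) \<le> ln (real x)" using p1 by (simp add: ln_realpow)
      then have "real k \<le> ln (real x) / ln (real p)" using p1 by (simp add: field_simps)
      then have "k \<le> K" by (simp add: K_def le_nat_floor)
      with k(2) show "d \<in> (\<lambda>k. p ^ k) ` {1..K}" unfolding dk by auto
    qed
    then have "card {d. d \<in> D \<and> aprimedivisor d = p} \<le> card ((\<lambda>k. p ^ k) ` {1..K})"
      by (intro card_mono) auto
    also have "\<dots> \<le> K" using card_image_le[of "{1..K}" "\<lambda>k. p ^ k"] by simp
    finally have "real (card {d. d \<in> D \<and> aprimedivisor d = p}) * ln (real p) \<le> real K * ln (real p)"
      using p1 by (intro mult_right_mono) auto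
    also have "real K \<le> ln (real x) / ln (real p)"
      unfolding K_def using p1 assms by (intro of_nat_floor) auto
    then have "real K * ln (real p) \<le> ln (real x)" using p1 by (simp add: field_simps)
    finally show "(\<Sum>d | d \<in> D \<and> aprimedivisor d = p. ln (real (aprimedivisor d))) \<le> ln (real x)"
      by simp
  qed
  also have "\<dots> = real (card P) * ln (real x)" by simp
  finally show ?thesis by (simp add: P_def)
qed

text \<open>Consecutive quotients have ratio 6(6n+1)(6n+5) / ((n+1)(2n+1)), which tends to 108 from
  below. The extra factor \<open>n\<close> makes the induction step go through, and 4 covers the
  case \<open>n = 1\<close>.\<close>

lemma fact_quotient_lower_bound:
  assumes "n \<ge> 1"
  shows "108 ^ n * (fact (3 * n) * (fact (2 * n))\<^sup>2) \<le> 4 * real n * (fact (6 * n) * fact n)"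
  using assms
proof (induction n rule: nat_induct_at_least)
  case base
  show ?case by (simp add: fact_numeral)
next
  case (Suc n)
  define x where "x = real n"
  have x: "x \<ge> 1" using Suc by (simp add: x_def)
  define A :: real where "A = fact (3 * n) * (fact (2 * n))\<^sup>2"
  define B :: real where "B = fact (6 * n) * fact n"
  have f6: "fact (6 * Suc n) = 72 * (x+1) * (6*x+5) * (3*x+2) * (2*x+1) * (3*x+1) * (6*x+1) *
      (fact (6 * n) :: real)"
    by (simp add: x_def numeral_eq_Suc algebra_simps)
  have f3: "fact (3 * Suc n) = 3 * (x+1) * (3*x+2) * (3*x+1) * (fact (3 * n) :: real)"
    by (simp add: x_def numeral_eq_Suc algebra_simps)
  have f2: "fact (2 * Suc n) = 2 * (x+1) * (2*x+1) * (fact (2 * n) :: real)"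
    by (simp add: x_def numeral_eq_Suc algebra_simps)
  have f1: "fact (Suc n) = (x+1) * (fact n :: real)"
    by (simp add: x_def algebra_simps)
  \<comment> \<open>\<open>c\<close> collects the factors common to both sides; what remains is
    108x(2x+1) \<le> 6(6x+1)(6x+5).\<close>
  define c where "c = 12 * (x+1)^3 * (2*x+1) * (3*x+1) * (3*x+2)"
  have c: "c \<ge> 0" using x by (simp add: c_def)
  have "108 ^ Suc n * (fact (3 * Suc n) * (fact (2 * Suc n))\<^sup>2) = 
     108 * c * (2*x+1) * (108 ^ n * A)"
    unfolding f3 f2 A_def c_def
    by (simp add: power2_eq_square power3_eq_cube mult_ac
        del: distrib_left_numeral distrib_right_numeral)
  also have "\<dots> \<le> 108 * c * (2*x+1) * (4 * x * B)"
    using Suc.IH x c unfolding A_def B_def x_def by (intro mult_left_mono) auto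
  also have "\<dots> = 4 * B * c * (108 * x * (2*x+1))" by simp
  also have "\<dots> \<le> 4 * B * c * (6 * (6*x+1) * (6*x+5))"
    using x c by (intro mult_left_mono) (auto simp: B_def algebra_simps)
  also have "\<dots> = 4 * real (Suc n) * (fact (6 * Suc n) * fact (Suc n))"
    unfolding f6 f1 B_def c_def
    by (simp add: power3_eq_cube x_def add.commute mult_ac
        del: distrib_left_numeral distrib_right_numeral)
  finally show ?case .
qed

text \<open>All four floors depend only on \<open>k = 6 * n div d\<close>. Since 6 + 1 = 3 + 2 * 2,
  the multiples of \<open>k div 6\<close> cancel, leaving a check of the six residues of
  \<open>k\<close> modulo 6.\<close>

lemma floor_combination_le_one:
  fixes n d :: nat
  shows "6 * n div d + n div d \<le> 3 * n div d + 2 * (2 * n div d) + 1"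
proof -
  define k where "k = 6 * n div d"
  have "n div d = k div 6" "3 * n div d = k div 2" "2 * n div d = k div 3"
    using div_mult2_eq[of "6 * n" d 6] div_mult2_eq[of "6 * n" d 2] div_mult2_eq[of "6 * n" d 3]
      div_mult_mult1[of 6 n d] div_mult_mult1[of 2 "3 * n" d] div_mult_mult1[of 3 "2 * n" d]
    by (simp_all add: k_def mult.commute mult.left_commute)
  moreover have "k + k div 6 \<le> k div 2 + 2 * (k div 3) + 1"
  proof -
    define j where "j = k div 6"
    define r where "r = k mod 6"
    have k: "k = r + 2 * (3 * j)" "k = r + 3 * (2 * j)" "k = r + 6 * j"
      by (simp_all add: j_def r_def)
    have "k div 2 = 3 * j + r div 2" "k div 3 = 2 * j + r div 3"
      by (subst k(1), simp) (subst k(2), simp)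
    moreover have "r \<in> {0, 1, 2, 3, 4, 5}"
      by (simp add: r_def) linarith
    ultimately show ?thesis
      using k(3) by (auto simp flip: j_def)
  qed
  ultimately show ?thesis
    by (simp add: k_def)
qed

text \<open>In the logarithm of the factorial quotient each Mangoldt value has a coefficient of at
  most 1, so the sum dominates that logarithm.\<close>

lemma sum_mangoldt_ge:
  assumes "n \<ge> 1"
  shows "(\<Sum>d = 1..6 * n. mangoldt d) \<ge> real n * ln 108 - ln (4 * real n)"
proof -
  define F where "F k = (\<Sum>d = 1..6 * n. mangoldt d * real (k * n div d))" for k
  have F: "ln (fact (k * n)) = F k" if "k \<le> 6" for k
    unfolding F_def by (rule ln_fact_eq_sum_mangoldt) (use that in auto)
  have "ln (108 ^ n * (fact (3 * n) * (fact (2 * n))\<^sup>2))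
      \<le> ln (4 * real n * (fact (6 * n) * fact n))"
    using fact_quotient_lower_bound[OF assms] assms by (subst ln_le_cancel_iff) auto
  then have "real n * ln 108 + F 3 + 2 * F 2 \<le> ln (4 * real n) + F 6 + F 1"
    using assms F[of 1] F[of 2] F[of 3] F[of 6]
    by (simp add: ln_mult_pos ln_realpow)
  moreover have "F 6 + F 1 \<le> F 3 + 2 * F 2 + (\<Sum>d = 1..6 * n. mangoldt d)"
  proof -
    have "F 6 + F 1 = (\<Sum>d = 1..6 * n. mangoldt d * real (6 * n div d + n div d))"
      by (simp add: F_def sum.distrib ring_distribs)
    also have "\<dots> \<le> (\<Sum>d = 1..6 * n. mangoldt d * real (3 * n div d + 2 * (2 * n div d) + 1))"
      by (intro sum_mono mult_left_mono of_nat_mono floor_combination_le_one mangoldt_nonneg)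
    also have "\<dots> = F 3 + 2 * F 2 + (\<Sum>d = 1..6 * n. mangoldt d)"
      by (simp add: F_def sum.distrib ring_distribs sum_distrib_left mult_ac)
    finally show ?thesis .
  qed
  ultimately show ?thesis by linarith
qed

text \<open>The constant comes from ln 108 = 2 ln 2 + 3 ln 3 \<ge> 2 * 2/3 + 3. Rounding
  \<open>N\<close> down to a multiple of 6 costs the \<open>- 1\<close>, and leaving out the prime 2
  costs the last \<open>ln N\<close>.\<close>

lemma card_odd_primes_ge:
  assumes "N \<ge> 6"
  shows "real (card {l. prime l \<and> odd l \<and> l \<le> N}) * ln (real N)
    \<ge> 13 / 3 * (real N / 6 - 1) - ln (4 * real N) - ln (real N)"
proof -
  define n where "n = N div 6"
  have n: "n \<ge> 1" "6 * n \<le> N" "real n \<ge> real N / 6 - 1"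
    using assms unfolding n_def by linarith+
  have "ln (108::real) = ln (2 ^ 2 * 3 ^ 3)" by simp
  also have "\<dots> = 2 * ln 2 + 3 * ln 3" by (subst ln_mult_pos) (simp_all add: ln_realpow del: power_numeral)
  finally have 108: "ln (108::real) = 2 * ln 2 + 3 * ln 3" .
  have "1 \<le> ln (3::real)"
    using exp_le by (subst ln_ge_iff) auto
  with 108 have 108: "ln (108::real) \<ge> 13 / 3"
    using ln2_ge_two_thirds by simp
  define P where "P = {l. prime l \<and> l \<le> N}"
  have fP: "finite P" by (simp add: P_def)
  have "card P \<le> card (insert 2 {l. prime l \<and> odd l \<and> l \<le> N})"
    by (intro card_mono) (auto simp: P_def, metis primes_dvd_imp_eq two_is_prime_nat)
  also have "\<dots> \<le> card {l. prime l \<and> odd l \<and> l \<le> N} + 1"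
    by (simp add: card_insert_if)
  finally have P: "real (card P) \<le> real (card {l. prime l \<and> odd l \<and> l \<le> N}) + 1" by linarith
  have "13 / 3 * (real N / 6 - 1) \<le> 13 / 3 * real n" using n by simp
  also have "\<dots> \<le> real n * ln 108" using mult_left_mono[OF 108, of "real n"] by (simp add: mult.commute)
  also have "\<dots> \<le> (\<Sum>d = 1..6 * n. mangoldt d) + ln (4 * real n)"
    using sum_mangoldt_ge[OF n(1)] by simp
  also have "ln (4 * real n) \<le> ln (4 * real N)"
    using n by (subst ln_le_cancel_iff) auto
  also have "(\<Sum>d = 1..6 * n. mangoldt d) \<le> (\<Sum>d = 1..N. mangoldt d :: real)"
    using n by (intro sum_mono2) (auto simp: mangoldt_nonneg)
  also have "\<dots> \<le> real (card P) * ln (real N)"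
    unfolding P_def using assms by (intro sum_mangoldt_le) auto
  also have "\<dots> \<le> (real (card {l. prime l \<and> odd l \<and> l \<le> N}) + 1) * ln (real N)"
    using P assms by (intro mult_right_mono) auto
  finally show ?thesis by (simp add: algebra_simps)
qed

section \<open>Collisions between Fermat quotients\<close>

text \<open>In the factorization of \<open>x ^ p - y ^ p\<close> the cofactor of
  \<open>x - y\<close> is congruent to p y^(p-1), so \<open>p\<close> divides both factors.\<close>

lemma cong_pow_prime_square:
  fixes x y :: int
  assumes "[x = y] (mod int p)"
  shows "[x ^ p = y ^ p] (mod (int p)\<^sup>2)"
proof -
  have "[(\<Sum>i<p. y ^ (p - Suc i) * x ^ i) = (\<Sum>i<p. y ^ (p - Suc i) * y ^ i)] (mod int p)"
    by (intro cong_sum cong_mult cong_pow cong_refl assms)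
  also have "(\<Sum>i<p. y ^ (p - Suc i) * y ^ i) = (\<Sum>i<p. y ^ (p - 1))"
    by (intro sum.cong refl) (auto simp flip: power_add)
  also have "[\<dots> = 0] (mod int p)" by (simp add: cong_0_iff)
  finally have "int p dvd (\<Sum>i<p. y ^ (p - Suc i) * x ^ i)" by (simp add: cong_0_iff)
  moreover have "int p dvd x - y" using assms by (simp add: cong_iff_dvd_diff)
  moreover have "x ^ p - y ^ p = (x - y) * (\<Sum>i<p. y ^ (p - Suc i) * x ^ i)"
    by (rule power_diff_sumr2)
  ultimately show ?thesis
    by (simp add: cong_iff_dvd_diff power2_eq_square mult_dvd_mono)
qed

lemma fermat_quotient_eq_imp_cong:
  assumes "prime p" "coprime a (int p)" "coprime b (int p)"
    and "fermat_quotient p a = fermat_quotient p b"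
  shows "[a ^ (p - 1) = b ^ (p - 1)] (mod (int p)\<^sup>2)"
proof -
  define A where "A = (a ^ (p - 1) - 1) div int p"
  define B where "B = (b ^ (p - 1) - 1) div int p"
  have "a ^ (p - 1) - 1 = int p * A" "b ^ (p - 1) - 1 = int p * B"
    using fermat_quotient_exact[OF assms(1)] assms(2,3) by (simp_all add: A_def B_def)
  then have "a ^ (p - 1) - b ^ (p - 1) = int p * (A - B)" by (simp add: algebra_simps)
  moreover have "int p dvd A - B"
    using assms(4) by (simp add: fermat_quotient_def A_def B_def mod_eq_dvd_iff)
  ultimately show ?thesis
    by (simp add: cong_iff_dvd_diff power2_eq_square mult_dvd_mono)
qed

text \<open>Cauchy-Schwarz for the fibre sizes: they sum to \<open>card S\<close>, and their squares
  sum to the number of collisions.\<close>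

lemma card_squared_le_card_image_times_collisions:
  assumes "finite S"
  shows "(card S)\<^sup>2 \<le> card (f ` S) * card {(a, b) \<in> S \<times> S. f a = f b}"
proof -
  define F where "F v = {a \<in> S. f a = v}" for v
  have fF: "finite (F v)" for v using assms by (simp add: F_def)
  have "(\<Sum>v\<in>f ` S. card (F v)) = card S"
    using sum.group[OF assms finite_imageI[OF assms], of f f "\<lambda>_. 1::nat"] by (simp add: F_def)
  moreover have "card {(a, b) \<in> S \<times> S. f a = f b} = (\<Sum>v\<in>f ` S. (card (F v))\<^sup>2)"
  proof -
    have "{(a, b) \<in> S \<times> S. f a = f b} = (\<Union>v\<in>f ` S. F v \<times> F v)"
      by (auto simp: F_def)
    moreover have "card (\<Union>v\<in>f ` S. F v \<times> F v) = (\<Sum>v\<in>f ` S. card (F v \<times> F v))"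
      using assms fF by (intro card_UN_disjoint) (auto simp: F_def)
    ultimately show ?thesis
      by (simp add: card_cartesian_product power2_eq_square)
  qed
  moreover have "(\<Sum>v\<in>f ` S. real (card (F v)))\<^sup>2 \<le>
      real (card (f ` S)) * (\<Sum>v\<in>f ` S. (real (card (F v)))\<^sup>2)"
    using sum_squared_le_sum_of_squares[of "\<lambda>v. real (card (F v))" "f ` S"] assms 
    by (simp add: mult.commute)
  ultimately have "real ((card S)\<^sup>2) \<le> real (card (f ` S) * card {(a, b) \<in> S \<times> S. f a = f b})"
    by (simp flip: of_nat_sum of_nat_power of_nat_mult)
  then show ?thesis by linarith
qed

lemma card_fermat_quotient_collisions:
  assumes p: "prime p" and S: "finite S" "\<And>l. l \<in> S \<Longrightarrow> prime l \<and> odd l \<and> l < p"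
  shows "2 * card {(a, b) \<in> S \<times> S. fermat_quotient p (int a) = fermat_quotient p (int b)}
    \<le> 2 * card S + p"
proof -
  define q where "q a = fermat_quotient p (int a)" for a
  define C where "C = {(a, b) \<in> S \<times> S. q a = q b \<and> a \<noteq> b}"
  define T where "T = C \<times> {1, -1 :: int}"
  \<comment> \<open>By Fermat, \<open>b ^ (p - 2)\<close> inverts \<open>b\<close> modulo
    \<open>p\<close>, so \<open>h\<close> is the residue of \<open>s * a / b\<close>.\<close>
  define h where "h = (\<lambda>((a, b), s). (s * int a * int b ^ (p - 2)) mod int p)"
  have cop: "coprime (int l) (int p)" if "l \<in> S" for l
    using S(2)[OF that] p by (auto intro: primes_coprime)
  have p0: "p > 0" using p prime_gt_0_nat by auto
  have oddp: "odd p" if "l \<in> S" for l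
  proof -
    have "p > 2" using S(2)[OF that] prime_ge_2_nat[of l] by auto
    then show ?thesis using p prime_odd_nat by auto
  qed
  have inj: "a = c \<and> b = d \<and> s = t"
    if 1: "(a, b) \<in> C" "(c, d) \<in> C" "s \<in> {1, -1}" "t \<in> {1, -1}"
      and eq: "h ((a, b), s) = h ((c, d), t)" for a b c d s t
  proof -
    have mem: "a \<in> S" "b \<in> S" "c \<in> S" "d \<in> S" "a \<noteq> b" "c \<noteq> d" "q a = q b" "q c = q d"
      using 1 by (auto simp: C_def)
    note primes = mem(1-4)[THEN S(2)]
    have inv: "[int l ^ (p - 2) * int l = 1] (mod int p)" if "l \<in> S" for l
    proof -
      have "\<not> p dvd l" using S(2)[OF that] prime_gt_0_nat[of l] by (auto dest: dvd_imp_le)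
      then have "[l ^ (p - 1) = 1] (mod p)" using p by (intro fermat_theorem)
      then have "[int l ^ (p - 1) = 1] (mod int p)"
        by (metis cong_int_iff of_nat_1 of_nat_power)
      moreover have "p - 1 = Suc (p - 2)" using prime_ge_2_nat[OF p] by simp
      ultimately show ?thesis by (simp add: mult.commute)
    qed
    \<comment> \<open>Equality of the two fractions, with denominators cleared, is
      \<open>X = Y\<close> modulo \<open>p\<close>.\<close>
    define X where "X = s * int a * int d"
    define Y where "Y = t * int c * int b"
    have "[s * int a * int b ^ (p - 2) * (int b * int d)
         = t * int c * int d ^ (p - 2) * (int b * int d)] (mod int p)"
      using eq by (intro cong_mult[OF _ cong_refl]) (simp add: h_def Cong.cong_def)
    moreover have "[s * int a * int b ^ (p - 2) * (int b * int d) = X] (mod int p)"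
      using cong_mult[OF inv[OF mem(2)] cong_refl[of X]] by (simp add: X_def mult_ac)
    moreover have "[t * int c * int d ^ (p - 2) * (int b * int d) = Y] (mod int p)"
      using cong_mult[OF inv[OF mem(4)] cong_refl[of Y]] by (simp add: Y_def mult_ac)
    ultimately have "[X = Y] (mod int p)" by (metis cong_sym cong_trans)
    then have "[X ^ p = Y ^ p] (mod (int p)\<^sup>2)" by (rule cong_pow_prime_square)
    \<comment> \<open>The collisions identify the \<open>(p - 1)\<close>-th powers modulo p^2, and
      the even exponent removes the signs. Comparing with the \<open>p\<close>-th powers and
      cancelling the unit \<open>Y ^ (p - 1)\<close> lifts \<open>X = Y\<close> to modulus
      p^2.\<close>
    moreover have "[X ^ (p - 1) = Y ^ (p - 1)] (mod (int p)\<^sup>2)"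
    proof -
      have "even (p - 1)" using oddp[OF mem(1)] by simp
      then have st: "s ^ (p - 1) = 1" "t ^ (p - 1) = 1" using 1 by auto
      have "[int a ^ (p - 1) * int d ^ (p - 1) = int b ^ (p - 1) * int c ^ (p - 1)] (mod (int p)\<^sup>2)"
        using mem by (intro cong_mult fermat_quotient_eq_imp_cong p cop) (auto simp: q_def)
      then show ?thesis by (simp add: X_def Y_def power_mult_distrib st mult_ac del: One_nat_def)
    qed
    then have "[X * X ^ (p - 1) = X * Y ^ (p - 1)] (mod (int p)\<^sup>2)"
      by (intro cong_mult cong_refl)
    moreover have "X ^ p = X * X ^ (p - 1)" "Y ^ p = Y * Y ^ (p - 1)"
      using p0 by (simp_all add: power_eq_if)
    ultimately have "[X * Y ^ (p - 1) = Y * Y ^ (p - 1)] (mod (int p)\<^sup>2)"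
      by (metis cong_sym cong_trans)
    moreover have "coprime (Y ^ (p - 1)) ((int p)\<^sup>2)"
      using cop[OF mem(2)] cop[OF mem(3)] 1 unfolding Y_def by auto
    ultimately have "[X = Y] (mod (int p)\<^sup>2)" by (simp add: cong_mult_rcancel)
    then obtain k where k: "X - Y = (int p)\<^sup>2 * k"
      by (auto simp: cong_iff_dvd_diff)
    have bnd: "\<bar>int x * int y\<bar> < (int p)\<^sup>2" if "x \<in> S" "y \<in> S" for x y
      using S(2)[OF that(1)] S(2)[OF that(2)] unfolding power2_eq_square
      by (auto simp flip: of_nat_mult intro: mult_strict_mono)
    have "\<bar>X\<bar> < (int p)\<^sup>2" "\<bar>Y\<bar> < (int p)\<^sup>2"
      using bnd[OF mem(1,4)] bnd[OF mem(3,2)] 1 by (auto simp: X_def Y_def)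
    moreover have "\<bar>X - Y\<bar> = (int p)\<^sup>2 * \<bar>k\<bar>"
      unfolding k by (simp add: abs_mult)
    ultimately have "(int p)\<^sup>2 * \<bar>k\<bar> < (int p)\<^sup>2 * 2"
      by linarith
    then have k1: "\<bar>k\<bar> < 2" using p0 by (subst (asm) mult_less_cancel_left_pos) auto
    \<comment> \<open>Parity is what allows both signs at once for all primes below \<open>p\<close>: \<open>X\<close> and \<open>Y\<close> are odd,
      so their difference cannot be \<open>\<plusminus>p\<^sup>2\<close>.\<close>
    have "even (X - Y)" using primes 1 by (auto simp: X_def Y_def)
    then have "even k" using k oddp[OF mem(1)] by simp
    with k1 have "k = 0" by presburger
    with k have XY: "X = Y" by simp
    \<comment> \<open>Positivity separates the signs; then the prime \<open>a\<close> divides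
      \<open>c * b\<close> and differs from \<open>b\<close>, which forces
      \<open>a = c\<close>.\<close>
    have pos: "int a * int d > 0" "int c * int b > 0"
      using primes by (auto simp: prime_gt_0_nat)
    have st: "s = t" 
      using XY pos 1 unfolding X_def Y_def by auto
    with XY 1 have "int a * int d = int c * int b" by (auto simp: X_def Y_def)
    then have eq': "a * d = c * b" by (simp flip: of_nat_mult)
    then have "a dvd c * b" by (metis dvd_triv_left)
    then have "a dvd c" using primes mem
      by (metis prime_dvd_mult_iff primes_dvd_imp_eq)
    then have "a = c" using primes by (metis primes_dvd_imp_eq)
    with eq' pos st show ?thesis by auto
  qed
  have "inj_on h T"
  proof (rule inj_onI)
    fix x y assume xy: "x \<in> T" "y \<in> T" "h x = h y"
    obtain a b s c d t where eqs: "x = ((a, b), s)" "y = ((c, d), t)"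
      by (metis surj_pair)
    with xy have "(a, b) \<in> C" "(c, d) \<in> C" "s \<in> {1, -1}" "t \<in> {1, -1}"
      unfolding T_def by blast+
    from inj[OF this xy(3)[unfolded eqs]] show "x = y"
      by (simp add: eqs)
  qed
  moreover have "h ` T \<subseteq> {0..<int p}"
    using p0 by (auto simp: h_def)
  ultimately have "card T \<le> card {0..<int p}"
    by (metis card_inj_on_le finite_atLeastLessThan_int)
  then have "2 * card C \<le> p" by (simp add: T_def card_cartesian_product)
  moreover have "card {(a, b) \<in> S \<times> S. q a = q b} \<le> card S + card C"
  proof -
    have "{(a, b) \<in> S \<times> S. q a = q b} = (\<lambda>a. (a, a)) ` S \<union> C" by (auto simp: C_def)
    then have "card {(a, b) \<in> S \<times> S. q a = q b} \<le> card ((\<lambda>a. (a, a)) ` S) + card C"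
      by (simp add: card_Un_le)
    with card_image_le[OF S(1), of "\<lambda>a. (a, a)"] show ?thesis by linarith
  qed
  ultimately show ?thesis by (simp add: q_def)
qed

text \<open>Leaving \<open>S\<close> free allows its size to be prescribed later, so that
  \<open>2 * card S\<close> is small against \<open>p\<close> without an upper bound for the number
  of primes.\<close>

lemma fermat_image_size_ge:
  assumes p: "prime p" and S: "finite S" "\<And>l. l \<in> S \<Longrightarrow> prime l \<and> odd l \<and> l \<le> N" and N: "N < p"
  shows "2 * (card S)\<^sup>2 \<le> fermat_image_size p N * (2 * card S + p)"
proof -
  define q where "q a = fermat_quotient p (int a)" for a
  define E where "E = card {(a, b) \<in> S \<times> S. q a = q b}"
  have "{q n | n. 1 \<le> n \<and> n \<le> N \<and> coprime n p} \<subseteq> q ` {1..N}" by auto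
  then have "finite {q n | n. 1 \<le> n \<and> n \<le> N \<and> coprime n p}"
    by (rule finite_subset) auto
  moreover have "q ` S \<subseteq> {q n | n. 1 \<le> n \<and> n \<le> N \<and> coprime n p}"
  proof safe
    fix l assume "l \<in> S"
    with S have l: "prime l" "l \<le> N" by auto
    with p N have "coprime l p" by (intro primes_coprime) auto
    with l prime_gt_0_nat[of l] show "\<exists>n. q l = q n \<and> 1 \<le> n \<and> n \<le> N \<and> coprime n p"
      by (intro exI[of _ l]) auto
  qed
  ultimately have I: "card (q ` S) \<le> fermat_image_size p N"
    unfolding fermat_image_size_def q_def by (rule card_mono)
  have "2 * (card S)\<^sup>2 \<le> card (q ` S) * (2 * E)"
    using card_squared_le_card_image_times_collisions[OF S(1), of q] by (simp add: E_def)
  also have "\<dots> \<le> fermat_image_size p N * (2 * card S + p)"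
    using card_fermat_quotient_collisions[OF p S(1)] S(2) N
    by (intro mult_mono I) (force simp: E_def q_def)+
  finally show ?thesis .
qed

section \<open>Choice of constants and the asymptotic bound\<close>

lemma eventually_fermat_image_size_ge:
  "\<forall>\<^sub>F N in sequentially. \<forall>p. prime p \<and> N < p \<longrightarrow>
     (real N)\<^sup>2 / (real p * (ln (real N))\<^sup>2) \<le> real (fermat_image_size p N)"
proof -
  \<comment> \<open>The leading coefficient on the left is 13/18, just above 5/7.\<close>
  have "\<forall>\<^sub>F N in sequentially.
      13 / 3 * (real N / 6 - 1) - ln (4 * real N) - ln (real N) \<ge> 5 / 7 * real N"
    by real_asymp
  \<comment> \<open>The \<open>+ 1\<close> absorbs the ceiling in \<open>m\<close>. The resulting
    \<open>m \<le> N / 98\<close> gives \<open>2 * m + p \<le> 50 / 49 * p\<close>.\<close>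
  moreover have "\<forall>\<^sub>F N in sequentially. 5 / 7 * real N / ln (real N) + 1 \<le> real N / 98"
    by real_asymp
  ultimately show ?thesis
    using eventually_ge_at_top[of 6]
  proof eventually_elim
    case (elim N)
    define L where "L = ln (real N)"
    have L: "L > 0" using elim by (simp add: L_def)
    define P where "P = {l. prime l \<and> odd l \<and> l \<le> N}"
    define m where "m = nat \<lceil>5 / 7 * real N / L\<rceil>"
    have m: "5 / 7 * real N / L \<le> real m" "real m \<le> real N / 98"
      using elim L unfolding m_def L_def[symmetric] by linarith+
    have mL: "5 / 7 * real N \<le> real m * L" using m(1) L by (simp add: field_simps)
    have "5 / 7 * real N \<le> real (card P) * L"
      using elim card_odd_primes_ge[of N] unfolding P_def L_def by linarith
    then have "5 / 7 * real N / L \<le> real (card P)" using L by (simp add: field_simps)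
    then have "m \<le> card P" unfolding m_def by linarith
    then obtain S where S: "S \<subseteq> P" "card S = m" "finite S"
      by (rule obtain_subset_with_card_n)
    show ?case
    proof (intro allI impI)
      fix p assume p: "prime p \<and> N < p"
      define I where "I = real (fermat_image_size p N)"
      have p0: "real p > 0" "real N < real p" using p by auto
      have "2 * m\<^sup>2 \<le> fermat_image_size p N * (2 * m + p)"
        using fermat_image_size_ge[of p S N] p S by (auto simp: P_def)
      then have "real (2 * m\<^sup>2) \<le> real (fermat_image_size p N * (2 * m + p))"
        by (rule of_nat_mono)
      then have "2 * (real m)\<^sup>2 \<le> I * (2 * real m + real p)" by (simp add: I_def)
      also have "\<dots> \<le> I * (50 / 49 * real p)"
        using m p0 by (intro mult_left_mono) (auto simp: I_def)
      \<comment> \<open>Here 2 * 49/50 = 49/25 = (7/5)^2, which exactly offsets the constant 5/7 in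
        the size of \<open>m\<close>.\<close>
      finally have I: "49 / 25 * (real m)\<^sup>2 \<le> I * real p" by simp
      have "(real N)\<^sup>2 = 49 / 25 * (5 / 7 * real N)\<^sup>2" by (simp add: power2_eq_square)
      also have "\<dots> \<le> 49 / 25 * (real m * L)\<^sup>2"
        using mL by (intro mult_left_mono power_mono) auto
      also have "\<dots> = 49 / 25 * (real m)\<^sup>2 * L\<^sup>2" by (simp add: power_mult_distrib)
      also have "\<dots> \<le> I * real p * L\<^sup>2" using I by (intro mult_right_mono) auto
      finally show "(real N)\<^sup>2 / (real p * (ln (real N))\<^sup>2) \<le> real (fermat_image_size p N)"
        using p0 L by (simp add: field_simps I_def flip: L_def)
    qed
  qed
qed

theorem theorem11:
  "\<exists>\<epsilon> :: nat \<Rightarrow> real. \<epsilon> \<longlonglongrightarrow> 0 \<and>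
     (\<forall>(p::nat) (N::nat). prime p \<and> 2 \<le> N \<and> N < p \<longrightarrow>
        real (fermat_image_size p N) \<ge> (1 + \<epsilon> N) * ((real N)\<^sup>2 / (real p * (ln (real N))\<^sup>2)))"
proof -
  obtain N0 where N0: "\<And>N p. N \<ge> N0 \<Longrightarrow> prime p \<Longrightarrow> N < p \<Longrightarrow>
      (real N)\<^sup>2 / (real p * (ln (real N))\<^sup>2) \<le> real (fermat_image_size p N)"
    using eventually_fermat_image_size_ge unfolding eventually_sequentially by blast
  \<comment> \<open>The value -1 makes the bound 0 for the small \<open>N\<close>; uniformity in
    \<open>p\<close> holds because \<open>N0\<close> is independent of \<open>p\<close>.\<close>
  define \<epsilon> :: "nat \<Rightarrow> real" where "\<epsilon> N = (if N \<ge> N0 then 0 else -1)" for N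
  have "\<epsilon> \<longlonglongrightarrow> 0"
    by (rule tendsto_eventually)
       (use eventually_ge_at_top[of N0] in eventually_elim, simp add: \<epsilon>_def)
  with N0 show ?thesis
    by (intro exI[of _ \<epsilon>]) (auto simp: \<epsilon>_def)
qed

end
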